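(* For any $c\in(0,1)$ there exists a ($\mathcal{C}^1$) piecewise monotone transformation $T:[0,1]\to[0,1]$ with a non-trivial discontinuity, for which $\Lambda^{\inf}(T,\tfrac1{|T'|})=\Lambda^{\sup}(T,\tfrac1{|T'|})=:\Lambda(T,\tfrac{1}{|T'|})$, such that $$\lim_{n\to\infty}\Big\|\frac{1}{(T^n)'}\Big\|_{L^\infty}^{1/n}-\Lambda\big(T,\tfrac{1}{|T'|}\big)>c.$$
   Context: A map $T:[0,1]\to[0,1]$ is a $\mathcal{C}^{r}$ piecewise monotone transformation if there is a finite partition $\Omega$ of a full measure subset of $[0,1]$ into open intervals such that $T|_\omega$ is strictly monotone and $r$-times differentiable with continuous derivative for each $\omega\in\Omega$; $\Omega$ always denotes the maximal such partition (the one with the largest elements). $\mathcal{I}$ denotes the disjoint union of the closed intervals $\overline{\omega}$, $\omega\in\Omega$. $T$ is viewed as a map on $\mathcal{I}$: for an endpoint $a\in\partial\omega$, regarded as a point of $\overline\omega$, $T^k a$ denotes the one-sided limit of $T^k x$ as $x\to a$, $x\in\omega$, and, for a weight $\varphi$, $\varphi(T^k a)$ denotes the corresponding limit of $\varphi(T^k x)$. A point $a\in\mathcal{I}$ is a non-trivial discontinuity of $T$ if $a\in\partial\omega$ for some $\omega\in\Omega$ and $\{T^k a\}_{k=1}^\infty$ is an infinite set. For such $a$, $$\Lambda^{\inf}(T,\varphi,a)=\liminf_{n\to\infty}\Big|\prod_{k=1}^n\varphi(T^k a)\Big|^{1/n},\qquad \Lambda^{\sup}(T,\varphi,a)=\limsup_{n\to\infty}\Big|\prod_{k=1}^n\varphi(T^k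 a)\Big|^{1/n}.$$ $\Lambda^{\inf}(T,\varphi)$ and $\Lambda^{\sup}(T,\varphi)$ are the maxima of $\Lambda^{\inf}(T,\varphi,a)$ and $\Lambda^{\sup}(T,\varphi,a)$, respectively, over the (finitely many) non-trivial discontinuities $a$. When the two coincide, the common value is denoted $\Lambda(T,\varphi)$. *)

theory Defs
  imports "HOL-Analysis.Analysis" "HOL-Probability.Essential_Supremum"
begin

(* Used for open sets S only, where deriv (a two-sided derivative) is the right notion. *)
definition Cr_on :: "nat \<Rightarrow> real set \<Rightarrow> (real \<Rightarrow> real) \<Rightarrow> bool" where
  "Cr_on r S f \<longleftrightarrow>
     (\<forall>k<r. (deriv ^^ k) f differentiable_on S) \<and> continuous_on S ((deriv ^^ r) f)"

definition branch_partition :: "nat \<Rightarrow> (real \<Rightarrow> real) \<Rightarrow> real set set \<Rightarrow> bool" where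
  "branch_partition r T \<Omega> \<longleftrightarrow>
     finite \<Omega> \<and>
     (\<exists>A \<subseteq> {0..1}. negligible ({0..1} - A) \<and> partition_on A \<Omega>) \<and>
     (\<forall>\<omega>\<in>\<Omega>. (\<exists>u v. \<omega> = {u<..<v}) \<and>
            (strict_mono_on \<omega> T \<or> strict_antimono_on \<omega> T) \<and> Cr_on r \<omega> T)"

(* Maps of [0,1] are total functions on the reals whose values outside [0,1] play no role. *)
definition piecewise_monotone :: "nat \<Rightarrow> (real \<Rightarrow> real) \<Rightarrow> bool" where
  "piecewise_monotone r T \<longleftrightarrow> T \<in> {0..1} \<rightarrow> {0..1} \<and> (\<exists>\<Omega>. branch_partition r T \<Omega>)"

(* Every other admissible partition refines \<Omega>; this determines \<Omega>. *)
definition maximal_branch_partition :: "nat \<Rightarrow> (real \<Rightarrow> real) \<Rightarrow> real set set \<Rightarrow> bool" where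
  "maximal_branch_partition r T \<Omega> \<longleftrightarrow>
     branch_partition r T \<Omega> \<and>
     (\<forall>\<Omega>'. branch_partition r T \<Omega>' \<longrightarrow> (\<forall>\<omega>'\<in>\<Omega>'. \<exists>\<omega>\<in>\<Omega>. \<omega>' \<subseteq> \<omega>))"

lemma maximal_branch_partition_unique:
  assumes "maximal_branch_partition r T \<Omega>" "maximal_branch_partition r T \<Omega>'"
  shows "\<Omega> = \<Omega>'"
proof -
  have sub: "P \<subseteq> Q"
    if P: "maximal_branch_partition r T P" and Q: "maximal_branch_partition r T Q" for P Q
  proof
    fix X assume X: "X \<in> P"
    have part: "disjoint P" "{} \<notin> P"
      using P by (auto simp: maximal_branch_partition_def branch_partition_def partition_on_def)
    have refine: "\<exists>Z\<in>R'. Y \<subseteq> Z"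
      if "maximal_branch_partition r T R" "maximal_branch_partition r T R'" "Y \<in> R" for R R' Y
      using that unfolding maximal_branch_partition_def by fast
    obtain Y where Y: "Y \<in> Q" "X \<subseteq> Y"
      using refine[OF P Q X] by (elim bexE)
    obtain Z where Z: "Z \<in> P" "Y \<subseteq> Z"
      using refine[OF Q P Y(1)] by (elim bexE)
    have "X \<subseteq> Z"
      using Y(2) Z(2) by (rule subset_trans)
    moreover have "X \<noteq> {}"
      using part(2) X by auto
    ultimately have "X \<inter> Z \<noteq> {}"
      by (simp add: Int_absorb2)
    then have "X = Z"
      using disjointD[OF part(1) X Z(1)] by (cases "X = Z") simp_all
    then have "X = Y"
      using Y(2) Z(2) by simp
    then show "X \<in> Q"
      using Y(1) by simp
  qed
  show ?thesis
    by (intro equalityI sub assms)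
qed

(* A point of the disjoint union of the closed intervals is a pair (\<omega>, a) with a in the
   closure of \<omega>.  For an endpoint a of \<omega>, orbit_weight T id (\<omega>, a) k is T^k a and
   orbit_weight T \<phi> (\<omega>, a) k is \<phi>(T^k a), both as limits taken from inside \<omega>. *)
definition orbit_weight ::
  "(real \<Rightarrow> real) \<Rightarrow> (real \<Rightarrow> real) \<Rightarrow> real set \<times> real \<Rightarrow> nat \<Rightarrow> real" where
  "orbit_weight T \<phi> p k = (case p of (\<omega>, a) \<Rightarrow> Lim (at a within \<omega>) (\<lambda>x. \<phi> ((T ^^ k) x)))"

definition nontrivial_discontinuities ::
  "(real \<Rightarrow> real) \<Rightarrow> real set set \<Rightarrow> (real set \<times> real) set" where
  "nontrivial_discontinuities T \<Omega> =
     {(\<omega>, a). \<omega> \<in> \<Omega> \<and> a \<in> frontier \<omega> \<and> infinite {orbit_weight T id (\<omega>, a) k | k. k \<ge> 1}}"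

(* Lim is arbitrary when there is no limit, so the quantities below are meaningful only for
   weights satisfying this. *)
definition has_orbit_weights ::
  "(real \<Rightarrow> real) \<Rightarrow> real set set \<Rightarrow> (real \<Rightarrow> real) \<Rightarrow> bool" where
  "has_orbit_weights T \<Omega> \<phi> \<longleftrightarrow>
     (\<forall>(\<omega>, a) \<in> nontrivial_discontinuities T \<Omega>. \<forall>k\<ge>1.
        \<exists>l. ((\<lambda>x. \<phi> ((T ^^ k) x)) \<longlongrightarrow> l) (at a within \<omega>))"

definition Lambda_inf_at ::
  "(real \<Rightarrow> real) \<Rightarrow> (real \<Rightarrow> real) \<Rightarrow> real set \<times> real \<Rightarrow> ereal" where
  "Lambda_inf_at T \<phi> p = liminf (\<lambda>n. ereal (root n \<bar>\<Prod>k=1..n. orbit_weight T \<phi> p k\<bar>))"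

definition Lambda_sup_at ::
  "(real \<Rightarrow> real) \<Rightarrow> (real \<Rightarrow> real) \<Rightarrow> real set \<times> real \<Rightarrow> ereal" where
  "Lambda_sup_at T \<phi> p = limsup (\<lambda>n. ereal (root n \<bar>\<Prod>k=1..n. orbit_weight T \<phi> p k\<bar>))"

definition Lambda_inf ::
  "(real \<Rightarrow> real) \<Rightarrow> real set set \<Rightarrow> (real \<Rightarrow> real) \<Rightarrow> ereal" where
  "Lambda_inf T \<Omega> \<phi> = Max (Lambda_inf_at T \<phi> ` nontrivial_discontinuities T \<Omega>)"

definition Lambda_sup ::
  "(real \<Rightarrow> real) \<Rightarrow> real set set \<Rightarrow> (real \<Rightarrow> real) \<Rightarrow> ereal" where
  "Lambda_sup T \<Omega> \<phi> = Max (Lambda_sup_at T \<phi> ` nontrivial_discontinuities T \<Omega>)"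

(* A point with T' x = 0 is given the value 0 by real division.  Strict monotonicity makes
   T' nonzero on a dense set, so near such a point the weight is unbounded, and
   has_orbit_weights fails if an orbit of limits runs into it. *)
definition inv_deriv_weight :: "(real \<Rightarrow> real) \<Rightarrow> real \<Rightarrow> real" where
  "inv_deriv_weight T x = 1 / \<bar>deriv T x\<bar>"

definition Linf_norm :: "(real \<Rightarrow> ereal) \<Rightarrow> ereal" where
  "Linf_norm f = esssup (lebesgue_on {0..1}) (\<lambda>x. \<bar>f x\<bar>)"

(* Division in ereal, so that 1/(T^n)' is infinite where (T^n)' vanishes. *)
definition inv_deriv_iterate_norm :: "(real \<Rightarrow> real) \<Rightarrow> nat \<Rightarrow> ereal" where
  "inv_deriv_iterate_norm T n = Linf_norm (\<lambda>x. 1 / ereal (deriv (T ^^ n) x))"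

end

theory Submission
  imports Defs
begin

text \<open>
  The infinite orbits of discontinuities may all stay in one part of the interval, while the
  growth of \<open>1 / (T^n)'\<close> is dominated by a fixed point of small slope in another invariant part,
  which none of them approaches.  The map below has two invariant
  branches.  On \<open>[0, 1/2]\<close> it is a quadratic polynomial fixing both endpoints, and its slope
  \<open>1/4 + 3 * x\<close> is smallest at the fixed point 0: hence neither endpoint has an infinite orbit,
  while \<open>1 / (T^n)'\<close> is at most \<open>4^n\<close> and comes arbitrarily close to \<open>4^n\<close> near 0.  On
  \<open>(1/2, 1]\<close> it is affine of slope \<open>1/2\<close> and contracts towards the fixed endpoint 1.  The
  right-hand side of \<open>1/2\<close> is therefore the only non-trivial discontinuity, and every factor
  of its weight product is 2.  So the limit of the norms is 4 and \<open>\<Lambda> = 2\<close>, and the gap 2 exceeds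
  every \<open>c < 1\<close>.

  The norms are computed in \<open>inv_deriv_iterate_norm_two_branch\<close>, and the discontinuities and
  their weights in \<open>nontrivial_discontinuities_two_branch\<close> and \<open>orbit_weight_right_branch\<close>.
\<close>

section \<open>A map with two invariant branches\<close>

definition two_branch :: "real \<Rightarrow> real" where
  "two_branch x = (if x \<le> 1/2 then x / 4 + 3/2 * x\<^sup>2 else (1 + x) / 2)"

definition two_branch_slope :: "real \<Rightarrow> real" where
  "two_branch_slope x = (if x \<le> 1/2 then 1/4 + 3 * x else 1/2)"

abbreviation left_branch :: "real set" where "left_branch \<equiv> {0<..<1/2}"

abbreviation right_branch :: "real set" where "right_branch \<equiv> {1/2<..<1}"

abbreviation branches :: "real set set" where "branches \<equiv> {left_branch, right_branch}"

lemma DERIV_two_branch: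
  assumes "x \<noteq> 1/2"
  shows "(two_branch has_real_derivative two_branch_slope x) (at x)"
proof (cases "x < 1/2")
  case True
  have "((\<lambda>x. x / 4 + 3/2 * x\<^sup>2) has_real_derivative two_branch_slope x) (at x)"
    using True by (auto intro!: derivative_eq_intros simp: two_branch_slope_def)
  then show ?thesis
    by (rule has_field_derivative_transform_within_open[where S = "{..<1/2}"])
       (use True in \<open>auto simp: two_branch_def\<close>)
next
  case False
  have "((\<lambda>x. (1 + x) / 2) has_real_derivative two_branch_slope x) (at x)"
    using False assms by (auto intro!: derivative_eq_intros simp: two_branch_slope_def)
  then show ?thesis
    by (rule has_field_derivative_transform_within_open[where S = "{1/2<..}"])
       (use False assms in \<open>auto simp: two_branch_def\<close>)
qed

lemma deriv_two_branch: "x \<noteq> 1/2 \<Longrightarrow> deriv two_branch x = two_branch_slope x"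
  by (rule DERIV_imp_deriv[OF DERIV_two_branch])

lemma two_branch_bounds_left:
  assumes "0 \<le> x" "x \<le> 1/2"
  shows "0 \<le> two_branch x" "two_branch x \<le> x"
proof -
  have "x * x \<le> x * (1/2)"
    using assms by (intro mult_left_mono) auto
  then show "0 \<le> two_branch x" "two_branch x \<le> x"
    using assms by (auto simp: two_branch_def power2_eq_square)
qed

lemma two_branch_left_closed: "two_branch ` {0..1/2} \<subseteq> {0..1/2}"
  using two_branch_bounds_left by force

lemma continuous_on_two_branch_left: "continuous_on {0..1/2} two_branch"
proof -
  have "continuous_on {0..1/2} (\<lambda>x::real. x / 4 + 3/2 * x\<^sup>2)"
    by (intro continuous_intros) simp
  then show ?thesis
    by (rule continuous_on_eq) (simp add: two_branch_def)
qed

lemma two_branch_nonneg: "0 \<le> x \<Longrightarrow> 0 \<le> two_branch x"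
  by (simp add: two_branch_def)

lemma two_branch_neq_half:
  assumes "0 \<le> x" "x \<noteq> 1/2"
  shows "two_branch x \<noteq> 1/2"
proof (cases "x < 1/2")
  case True
  then show ?thesis
    using two_branch_bounds_left[of x] assms by simp
next
  case False
  then show ?thesis
    using assms by (simp add: two_branch_def)
qed

section \<open>The branch partition\<close>

lemma branch_partition_two_branch: "branch_partition 1 two_branch branches"
  unfolding branch_partition_def
proof (intro conjI ballI)
  show "finite branches" by simp
  show "\<exists>A\<subseteq>{0..1}. negligible ({0..1} - A) \<and> partition_on A branches"
  proof (intro exI conjI)
    show "left_branch \<union> right_branch \<subseteq> {0..1}" by auto
    show "negligible ({0..1} - (left_branch \<union> right_branch))"
      by (rule negligible_subset[of "{0, 1/2, 1}"]) auto
    have "left_branch \<noteq> {}" "right_branch \<noteq> {}" by simp_all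
    then show "partition_on (left_branch \<union> right_branch) branches"
      by (auto simp: partition_on_def disjoint_def)
  qed
next
  fix \<omega> assume "\<omega> \<in> branches"
  then show "\<exists>u v. \<omega> = {u<..<v}" by auto
next
  fix \<omega> assume "\<omega> \<in> branches"
  have "strict_mono_on left_branch two_branch"
  proof (rule strict_mono_onI)
    fix x y :: real assume "x \<in> left_branch" "y \<in> left_branch" "x < y"
    moreover from this have "x\<^sup>2 < y\<^sup>2"
      by (intro power_strict_mono) auto
    ultimately show "two_branch x < two_branch y"
      by (simp add: two_branch_def)
  qed
  moreover have "strict_mono_on right_branch two_branch"
    by (rule strict_mono_onI) (auto simp: two_branch_def)
  ultimately show "strict_mono_on \<omega> two_branch \<or> strict_antimono_on \<omega> two_branch"
    using \<open>\<omega> \<in> branches\<close> by auto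
next
  fix \<omega> assume \<omega>: "\<omega> \<in> branches"
  have "two_branch differentiable_on \<omega>"
  proof (rule differentiable_at_imp_differentiable_on)
    fix x assume "x \<in> \<omega>"
    then have "x \<noteq> 1/2" using \<omega> by auto
    then show "two_branch differentiable at x"
      by (rule differentiableI[OF has_field_derivative_imp_has_derivative[OF DERIV_two_branch]])
  qed
  moreover have "continuous_on left_branch (deriv two_branch)"
  proof (rule continuous_on_eq)
    show "continuous_on left_branch (\<lambda>x. 1/4 + 3 * x)" by (intro continuous_intros)
  qed (auto simp: deriv_two_branch two_branch_slope_def)
  moreover have "continuous_on right_branch (deriv two_branch)"
  proof (rule continuous_on_eq)
    show "continuous_on right_branch (\<lambda>x. 1/2 :: real)" by (intro continuous_intros)
  qed (auto simp: deriv_two_branch two_branch_slope_def)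
  ultimately show "Cr_on 1 \<omega> two_branch"
    using \<omega> by (auto simp: Cr_on_def)
qed

text \<open>
  The value \<open>1/2\<close> at \<open>1/2\<close> and the right-hand limit \<open>3/4\<close> differ.  This is what makes the
  partition maximal: the map is differentiable, hence continuous, on every admissible interval,
  so no such interval contains \<open>1/2\<close>.
\<close>

lemma not_isCont_two_branch_half: "\<not> isCont two_branch (1/2)"
proof
  assume "isCont two_branch (1/2)"
  then have "(two_branch \<longlongrightarrow> two_branch (1/2)) (at_right (1/2))"
    unfolding isCont_def by (rule filterlim_mono) (auto simp: at_le)
  moreover have "(two_branch \<longlongrightarrow> 3/4) (at_right (1/2))"
  proof (rule Lim_transform_eventually)
    show "((\<lambda>x::real. (1 + x) / 2) \<longlongrightarrow> 3/4) (at_right (1/2))"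
      by (auto intro!: tendsto_eq_intros)
    show "\<forall>\<^sub>F x in at_right (1/2). (1 + x) / 2 = two_branch x"
      by (auto simp: eventually_at_filter two_branch_def)
  qed
  ultimately have "two_branch (1/2) = 3/4"
    by (intro tendsto_unique[of "at_right (1/2)"]) auto
  then show False
    by (simp add: two_branch_def power2_eq_square)
qed

lemma maximal_branch_partition_two_branch:
  "maximal_branch_partition 1 two_branch branches"
  unfolding maximal_branch_partition_def
proof (intro conjI allI impI ballI branch_partition_two_branch)
  fix \<Omega>' \<omega>' assume P: "branch_partition 1 two_branch \<Omega>'" and \<omega>': "\<omega>' \<in> \<Omega>'"
  obtain u v where uv: "\<omega>' = {u<..<v}" and diff: "two_branch differentiable_on \<omega>'"
    using P \<omega>' by (auto simp: branch_partition_def Cr_on_def)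
  have sub: "\<omega>' \<subseteq> {0..1}" and ne: "\<omega>' \<noteq> {}"
    using P \<omega>' by (auto simp: branch_partition_def partition_on_def)
  have "u < v" using ne uv by auto
  then have "0 \<le> u" "v \<le> 1"
    using sub uv greaterThanLessThan_subseteq_atLeastAtMost_iff[of u v 0 1] by auto
  moreover have "1/2 \<notin> \<omega>'"
  proof
    assume "1/2 \<in> \<omega>'"
    then have "isCont two_branch (1/2)"
      using differentiable_imp_continuous_on[OF diff] uv
      by (simp add: continuous_on_eq_continuous_at)
    then show False using not_isCont_two_branch_half by simp
  qed
  ultimately show "\<exists>\<omega>\<in>branches. \<omega>' \<subseteq> \<omega>"
    using uv by auto
qed

lemma piecewise_monotone_two_branch: "piecewise_monotone 1 two_branch"
  unfolding piecewise_monotone_def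
proof (intro conjI exI[of _ branches] branch_partition_two_branch Pi_I)
  fix x :: real assume x: "x \<in> {0..1}"
  show "two_branch x \<in> {0..1}"
  proof (cases "x \<le> 1/2")
    case True
    then show ?thesis using x two_branch_bounds_left[of x] by auto
  next
    case False
    then show ?thesis using x by (auto simp: two_branch_def)
  qed
qed

section \<open>Orbits of the discontinuities\<close>

lemma funpow_two_branch_left:
  "(two_branch ^^ k) ` {0..1/2} \<subseteq> {0..1/2} \<and> continuous_on {0..1/2} (two_branch ^^ k)"
proof (induction k)
  case (Suc k)
  have "continuous_on {0..1/2} (two_branch \<circ> two_branch ^^ k)"
    using Suc by (intro continuous_on_compose)
      (auto intro: continuous_on_subset[OF continuous_on_two_branch_left])
  moreover have "(two_branch \<circ> two_branch ^^ k) ` {0..1/2} \<subseteq> {0..1/2}"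
    using Suc two_branch_left_closed by (auto simp: image_subset_iff)
  ultimately show ?case by simp
qed auto

lemma funpow_two_branch_right:
  "1/2 < x \<Longrightarrow> (two_branch ^^ k) x = 1 - (1 - x) / 2 ^ k \<and> 1/2 < (two_branch ^^ k) x"
proof (induction k)
  case (Suc k)
  then have eq: "(two_branch ^^ k) x = 1 - (1 - x) / 2 ^ k" and gt: "1/2 < (two_branch ^^ k) x"
    by auto
  from gt have "two_branch ((two_branch ^^ k) x) = (1 + (two_branch ^^ k) x) / 2"
    by (simp add: two_branch_def)
  then have step: "(two_branch ^^ Suc k) x = (1 + (two_branch ^^ k) x) / 2" by simp
  have "(1 + (two_branch ^^ k) x) / 2 = 1 - (1 - x) / 2 ^ Suc k"
    unfolding eq by (simp add: field_simps)
  moreover have "1/2 < (1 + (two_branch ^^ k) x) / 2"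
    using gt by simp
  ultimately show ?case unfolding step by blast
qed simp

lemma two_branch_fixed_points: "two_branch 0 = 0" "two_branch (1/2) = 1/2"
  by (simp_all add: two_branch_def power2_eq_square)

lemma funpow_fixed_point: "f a = a \<Longrightarrow> (f ^^ k) a = a"
  by (induction k) auto

lemma frontier_branches: "frontier left_branch = {0, 1/2}" "frontier right_branch = {1/2, 1}"
  by (auto simp: frontier_def)

lemma at_within_branches_neq_bot:
  "at 0 within left_branch \<noteq> bot" "at (1/2) within left_branch \<noteq> bot"
  "at (1/2) within right_branch \<noteq> bot" "at 1 within right_branch \<noteq> bot"
  by (simp_all add: at_within_eq_bot_iff)

lemma orbit_weight_left:
  assumes "a \<in> {0, 1/2}"
  shows "orbit_weight two_branch id (left_branch, a) k = a"
proof -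
  have "((two_branch ^^ k) \<longlongrightarrow> (two_branch ^^ k) a) (at a within left_branch)"
    using funpow_two_branch_left[of k] assms
    by (auto simp: continuous_on_def intro: tendsto_within_subset[of _ _ _ "{0..1/2}"])
  moreover have "(two_branch ^^ k) a = a"
    using assms two_branch_fixed_points by (intro funpow_fixed_point) blast
  moreover have "at a within left_branch \<noteq> bot"
    using assms at_within_branches_neq_bot by blast
  ultimately show ?thesis
    by (simp add: orbit_weight_def tendsto_Lim)
qed

lemma orbit_weight_right:
  assumes "a \<in> {1/2, 1}"
  shows "orbit_weight two_branch id (right_branch, a) k = 1 - (1 - a) / 2 ^ k"
proof -
  have "((two_branch ^^ k) \<longlongrightarrow> 1 - (1 - a) / 2 ^ k) (at a within right_branch)"
  proof (rule Lim_transform_eventually)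
    show "((\<lambda>x. 1 - (1 - x) / 2 ^ k) \<longlongrightarrow> 1 - (1 - a) / 2 ^ k) (at a within right_branch)"
      by (intro tendsto_intros) simp
    show "\<forall>\<^sub>F x in at a within right_branch. 1 - (1 - x) / 2 ^ k = (two_branch ^^ k) x"
      by (simp add: eventually_at_filter funpow_two_branch_right)
  qed
  moreover have "at a within right_branch \<noteq> bot"
    using assms at_within_branches_neq_bot by blast
  ultimately show ?thesis
    by (simp add: orbit_weight_def tendsto_Lim)
qed

text \<open>
  Seen from inside their branches, 0, 1 and the left-hand side of \<open>1/2\<close> are fixed points, whereas
  the right-hand side of \<open>1/2\<close> has the strictly increasing orbit \<open>1 - 1 / 2^(k+1)\<close>.
\<close>

lemma nontrivial_discontinuities_two_branch:
  "nontrivial_discontinuities two_branch branches = {(right_branch, 1/2)}"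
proof -
  have "finite {orbit_weight two_branch id (left_branch, a) k | k. k \<ge> 1}" if "a \<in> {0, 1/2}" for a
    by (rule finite_subset[of _ "{a}"]) (use orbit_weight_left[OF that] in auto)
  moreover have "finite {orbit_weight two_branch id (right_branch, 1) k | k. k \<ge> 1}"
    by (rule finite_subset[of _ "{1}"]) (use orbit_weight_right[of 1] in auto)
  moreover have "infinite {orbit_weight two_branch id (right_branch, 1/2) k | k. k \<ge> 1}"
  proof -
    have "{orbit_weight two_branch id (right_branch, 1/2) k | k. k \<ge> 1}
        = (\<lambda>k. 1 - 1/2 / 2 ^ k) ` {1..}"
      using orbit_weight_right[of "1/2"] by auto
    moreover have "inj_on (\<lambda>k::nat. 1 - 1/2 / 2 ^ k :: real) {1..}"
      by (auto simp: inj_on_def)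
    ultimately show ?thesis
      by (simp add: finite_image_iff infinite_Ici)
  qed
  moreover have "left_branch \<noteq> right_branch"
  proof -
    have "(1/4 :: real) \<in> left_branch" "(1/4 :: real) \<notin> right_branch" by simp_all
    then show ?thesis by metis
  qed
  ultimately show ?thesis
    unfolding nontrivial_discontinuities_def using frontier_branches by auto
qed

lemma tendsto_weight_right_branch:
  "((\<lambda>x. inv_deriv_weight two_branch ((two_branch ^^ k) x)) \<longlongrightarrow> 2) (at (1/2) within right_branch)"
proof (rule tendsto_eventually)
  have "inv_deriv_weight two_branch ((two_branch ^^ k) x) = 2" if "1/2 < x" for x
  proof -
    have "1/2 < (two_branch ^^ k) x"
      using funpow_two_branch_right[OF that] by blast
    then have "deriv two_branch ((two_branch ^^ k) x) = 1/2"
      by (subst deriv_two_branch) (auto simp: two_branch_slope_def)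
    then show ?thesis unfolding inv_deriv_weight_def by (simp only:) simp
  qed
  then show "\<forall>\<^sub>F x in at (1/2) within right_branch.
      inv_deriv_weight two_branch ((two_branch ^^ k) x) = 2"
    by (simp add: eventually_at_filter)
qed

lemma orbit_weight_right_branch:
  "orbit_weight two_branch (inv_deriv_weight two_branch) (right_branch, 1/2) k = 2"
  using tendsto_Lim[OF at_within_branches_neq_bot(3) tendsto_weight_right_branch]
  by (simp add: orbit_weight_def)

lemma Lambda_two_branch:
  "Lambda_inf two_branch branches (inv_deriv_weight two_branch) = ereal 2"
  "Lambda_sup two_branch branches (inv_deriv_weight two_branch) = ereal 2"
proof -
  let ?r = "\<lambda>n. ereal (root n \<bar>\<Prod>k=1..n. orbit_weight two_branch (inv_deriv_weight two_branch)
                                        (right_branch, 1/2) k\<bar>)"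
  have "\<forall>\<^sub>F n in sequentially. ?r n = ereal 2"
    using eventually_ge_at_top[of 1]
    by eventually_elim (simp add: orbit_weight_right_branch real_root_power_cancel)
  then have "?r \<longlonglongrightarrow> ereal 2"
    by (rule tendsto_eventually)
  then show "Lambda_inf two_branch branches (inv_deriv_weight two_branch) = ereal 2"
    "Lambda_sup two_branch branches (inv_deriv_weight two_branch) = ereal 2"
    by (simp_all add: Lambda_inf_def Lambda_sup_def nontrivial_discontinuities_two_branch
        Lambda_inf_at_def Lambda_sup_at_def lim_imp_Liminf lim_imp_Limsup)
qed

section \<open>The norms of the inverse derivatives of the iterates\<close>

text \<open>
  By the chain rule this is the derivative of the \<open>n\<close>-th iterate along orbits that avoid the jump.
  As an explicit product it is Borel measurable on the whole line, and continuous on \<open>[0, 1/2]\<close>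
  with its endpoints.
\<close>

definition iterate_slope :: "nat \<Rightarrow> real \<Rightarrow> real" where
  "iterate_slope n x = (\<Prod>k<n. two_branch_slope ((two_branch ^^ k) x))"

lemma funpow_two_branch_avoids_half:
  "0 \<le> x \<Longrightarrow> x \<noteq> 1/2 \<Longrightarrow> 0 \<le> (two_branch ^^ k) x \<and> (two_branch ^^ k) x \<noteq> 1/2"
proof (induction k)
  case (Suc k)
  then show ?case
    using two_branch_nonneg two_branch_neq_half[of "(two_branch ^^ k) x"] by simp
qed simp

lemma deriv_funpow_two_branch:
  assumes "0 \<le> x" "x \<noteq> 1/2"
  shows "deriv (two_branch ^^ n) x = iterate_slope n x"
proof (rule DERIV_imp_deriv)
  show "((two_branch ^^ n) has_real_derivative iterate_slope n x) (at x)"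
  proof (induction n)
    case (Suc n)
    have "(two_branch has_real_derivative two_branch_slope ((two_branch ^^ n) x))
          (at ((two_branch ^^ n) x))"
      using funpow_two_branch_avoids_half[OF assms] by (intro DERIV_two_branch) simp
    from DERIV_chain[OF this Suc] show ?case
      by (simp add: iterate_slope_def mult.commute comp_def)
  qed (auto simp: iterate_slope_def id_def)
qed

lemma iterate_slope_ge:
  assumes "0 \<le> x"
  shows "(1/4) ^ n \<le> iterate_slope n x"
proof -
  have "0 \<le> (two_branch ^^ k) x" for k
    using assms by (induction k) (auto simp: two_branch_nonneg)
  then have "(\<Prod>k<n. 1/4) \<le> iterate_slope n x"
    unfolding iterate_slope_def by (intro prod_mono) (auto simp: two_branch_slope_def)
  then show ?thesis by simp
qed

lemma iterate_slope_pos: "0 \<le> x \<Longrightarrow> 0 < iterate_slope n x"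
  by (rule less_le_trans[OF _ iterate_slope_ge]) simp_all

lemma iterate_slope_0: "iterate_slope n 0 = (1/4) ^ n"
proof -
  have "(two_branch ^^ k) 0 = 0" for k
    using two_branch_fixed_points(1) by (rule funpow_fixed_point)
  then show ?thesis
    by (simp add: iterate_slope_def two_branch_slope_def)
qed

lemma continuous_on_iterate_slope: "continuous_on {0..1/2} (iterate_slope n)"
proof -
  have "continuous_on {0..1/2} (\<lambda>x. \<Prod>k<n. 1/4 + 3 * (two_branch ^^ k) x)"
    using funpow_two_branch_left by (intro continuous_intros) auto
  then show ?thesis
  proof (rule continuous_on_eq)
    fix x :: real assume "x \<in> {0..1/2}"
    then have "two_branch_slope ((two_branch ^^ k) x) = 1/4 + 3 * (two_branch ^^ k) x" for k
      using funpow_two_branch_left[of k] unfolding two_branch_slope_def by force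
    then show "(\<Prod>k<n. 1/4 + 3 * (two_branch ^^ k) x) = iterate_slope n x"
      by (simp add: iterate_slope_def)
  qed
qed

lemma borel_measurable_iterate_slope: "iterate_slope n \<in> borel_measurable borel"
proof -
  have [measurable]: "two_branch \<in> borel_measurable borel"
    unfolding two_branch_def by measurable
  have [measurable]: "two_branch_slope \<in> borel_measurable borel"
    unfolding two_branch_slope_def by measurable
  have [measurable]: "two_branch ^^ k \<in> borel_measurable borel" for k
    by (induction k) (auto intro: measurable_comp)
  show ?thesis unfolding iterate_slope_def by measurable
qed

text \<open>
  The bound \<open>4^n\<close> is approached only near the fixed point 0, so the lower estimate rests on the
  continuity of the slope of the iterate at 0: any smaller essential bound would be violated on a
  whole interval \<open>(0, b)\<close>.
\<close>

lemma inv_deriv_iterate_norm_two_branch: "inv_deriv_iterate_norm two_branch n = ereal (4 ^ n)"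
proof -
  define f where "f x = \<bar>1 / ereal (deriv (two_branch ^^ n) x)\<bar>" for x
  let ?M = "lebesgue_on {0..1::real}"
  have f_eq: "f x = ereal (1 / iterate_slope n x)" if "0 \<le> x" "x \<noteq> 1/2" for x
    using that iterate_slope_pos[OF that(1), of n]
    by (simp add: f_def deriv_funpow_two_branch one_ereal_def)
  have f_le: "f x \<le> ereal (4 ^ n)" if "0 \<le> x" "x \<noteq> 1/2" for x
  proof -
    have "1 / iterate_slope n x \<le> 1 / (1/4) ^ n"
      using iterate_slope_ge[OF that(1), of n] iterate_slope_pos[OF that(1), of n]
      by (intro divide_left_mono) auto
    then show ?thesis
      unfolding f_eq[OF that] by (simp add: power_one_over)
  qed
  have meas: "f \<in> borel_measurable ?M"
  proof -
    \<comment> \<open>At the jump the iterates need not be differentiable, so \<^term>\<open>f (1/2)\<close> is kept as it is.\<close>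
    have "(\<lambda>x. if x = 1/2 then f (1/2) else ereal (1 / iterate_slope n x)) \<in> borel_measurable borel"
      using borel_measurable_iterate_slope[of n] by measurable
    then have "(\<lambda>x. if x = 1/2 then f (1/2) else ereal (1 / iterate_slope n x)) \<in> borel_measurable ?M"
      by (intro measurable_restrict_space1 measurable_completion) simp
    then show ?thesis
    proof (rule measurable_cong[THEN iffD1, rotated])
      fix x assume "x \<in> space ?M"
      then have "0 \<le> x" by simp
      then show "(if x = 1/2 then f (1/2) else ereal (1 / iterate_slope n x)) = f x"
        using f_eq[of x] by presburger
    qed
  qed
  have "esssup ?M f \<le> ereal (4 ^ n)"
  proof (rule esssup_I[OF meas])
    have "AE x in lebesgue. x \<noteq> (1/2 :: real)"
      by (rule AE_I'[of "{1/2}"]) auto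
    then have "AE x in lebesgue. x \<in> {0..1} \<longrightarrow> f x \<le> ereal (4 ^ n)"
    proof eventually_elim
      case (elim x)
      then show ?case using f_le[of x] by simp
    qed
    then show "AE x in ?M. f x \<le> ereal (4 ^ n)"
      by (simp add: AE_restrict_space_iff)
  qed
  moreover have "\<not> esssup ?M f < ereal (4 ^ n)"
  proof
    assume less: "esssup ?M f < ereal (4 ^ n)"
    have "(iterate_slope n \<longlongrightarrow> iterate_slope n 0) (at 0 within {0..1/2})"
      using continuous_on_iterate_slope[of n] by (simp add: continuous_on_def)
    then have "((\<lambda>x. ereal (1 / iterate_slope n x)) \<longlongrightarrow> ereal (1 / (1/4) ^ n))
        (at_right 0)"
      unfolding iterate_slope_0 using at_within_Icc_at_right[of 0 "1/2::real"]
      by (intro tendsto_intros) auto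
    then have "((\<lambda>x. ereal (1 / iterate_slope n x)) \<longlongrightarrow> ereal (4 ^ n)) (at_right 0)"
      by (simp add: power_one_over)
    then have "\<forall>\<^sub>F x in at_right 0. esssup ?M f < ereal (1 / iterate_slope n x)"
      using less by (rule order_tendstoD)
    then obtain b where b: "0 < b"
        "\<And>x. 0 < x \<Longrightarrow> x < b \<Longrightarrow> esssup ?M f < ereal (1 / iterate_slope n x)"
      by (auto simp: eventually_at_right_field)
    define d where "d = min b (1/2)"
    have d: "0 < d" "d \<le> b" "d \<le> 1/2" using b(1) by (auto simp: d_def)
    have "AE x in lebesgue. x \<in> {0..1} \<longrightarrow> f x \<le> esssup ?M f"
      using esssup_AE[of f ?M] by (simp add: AE_restrict_space_iff)
    then have "AE x in lebesgue. x \<notin> {0<..<d}"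
    proof eventually_elim
      case (elim x)
      then show ?case using b(2)[of x] f_eq[of x] d by force
    qed
    then have "emeasure lebesgue {0<..<d} = 0"
      by (subst (asm) AE_iff_measurable[of "{0<..<d}"]) auto
    then show False using d(1) by simp
  qed
  ultimately show ?thesis
    by (simp add: inv_deriv_iterate_norm_def Linf_norm_def f_def[abs_def])
qed

theorem theorem2:
  fixes c :: real
  assumes "0 < c" and "c < 1"
  shows "\<exists>(T :: real \<Rightarrow> real) \<Omega> \<Lambda> \<rho>.
    piecewise_monotone 1 T \<and>
    maximal_branch_partition 1 T \<Omega> \<and>
    nontrivial_discontinuities T \<Omega> \<noteq> {} \<and>
    has_orbit_weights T \<Omega> (inv_deriv_weight T) \<and>
    Lambda_inf T \<Omega> (inv_deriv_weight T) = ereal \<Lambda> \<and>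
    Lambda_sup T \<Omega> (inv_deriv_weight T) = ereal \<Lambda> \<and>
    (\<forall>n\<ge>1. inv_deriv_iterate_norm T n < \<infinity>) \<and>
    (\<lambda>n. root n (real_of_ereal (inv_deriv_iterate_norm T n))) \<longlonglongrightarrow> \<rho> \<and>
    \<rho> - \<Lambda> > c"
proof (rule exI[of _ two_branch], rule exI[of _ branches], rule exI[of _ 2], rule exI[of _ 4],
    intro conjI piecewise_monotone_two_branch maximal_branch_partition_two_branch
    Lambda_two_branch)
  show "has_orbit_weights two_branch branches (inv_deriv_weight two_branch)"
    using tendsto_weight_right_branch
    by (auto simp: has_orbit_weights_def nontrivial_discontinuities_two_branch)
  show "(\<lambda>n. root n (real_of_ereal (inv_deriv_iterate_norm two_branch n))) \<longlonglongrightarrow> 4"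
  proof (rule tendsto_eventually)
    show "\<forall>\<^sub>F n in sequentially. root n (real_of_ereal (inv_deriv_iterate_norm two_branch n)) = 4"
      using eventually_ge_at_top[of 1]
      by eventually_elim (simp add: inv_deriv_iterate_norm_two_branch real_root_power_cancel)
  qed
  show "c < 4 - 2" using assms by simp
qed (simp_all add: nontrivial_discontinuities_two_branch inv_deriv_iterate_norm_two_branch)

end
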